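(* Let $X$ be a Banach space over $\mathbb F\in\{\mathbb R,\mathbb C\}$ and let $(x_n)$ be a bounded sequence in $X$. Then the following inequalities are valid: (a) $\delta(x_n)\ge 2\,\varepsilon_J^R(x_n)\ge 2\,\varepsilon_J(x_n)$; (b) $\widetilde\delta(x_n)\ge 2\,\varepsilon_J^R(x_n)\ge 2\,\varepsilon_J(x_n)$; (c) $\delta(x_n)\ge 2\,\widetilde{\varepsilon_J^R}(x_n)\ge 2\,\widetilde{\varepsilon_J}(x_n)$; (d) $\widetilde\delta(x_n)\le 2\,\widetilde{\varepsilon_J^R}(x_n)$; (e) $\widetilde\delta(x_n)\le \pi\,\widetilde{\varepsilon_J}(x_n)$ if $X$ is complex.
   Context: For a bounded sequence $(x_n)$ in a Banach space (or in the scalar field $\mathbb F$) put $\operatorname{ca}(x_n)=\inf_{n\in\mathbb N}\operatorname{diam}\{x_k: k\ge n\}$. For a bounded sequence $(x_n)$ in a Banach space $X$ over $\mathbb F$: $\delta(x_n)=\sup\{\operatorname{ca}(x^*(x_n)) : x^*\in B_{X^*}\}$, where $B_{X^*}$ is the closed unit ball of the dual; $\widetilde\delta(x_n)=\inf\{\delta(x_{n_k}) : (n_k)\text{ strictly increasing}\}$; $\varepsilon_J(x_n)=\sup_{n\in\mathbb N}\inf\{\|\sum_{k=n}^N\alpha_kx_k\| : N\ge n,\ \alpha_n,\dots,\alpha_N\in\mathbb F,\ \sum_{k=n}^N|\alpha_k|=1\}$; $\varepsilon_J^R(x_n)$ is defined by the same formula but with real coefficients $\alpha_n,\dots,\alpha_N\in\mathbb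 R$; $\widetilde{\varepsilon_J}(x_n)=\sup\{\varepsilon_J(x_{n_k}) : (n_k)\text{ strictly increasing}\}$ and $\widetilde{\varepsilon_J^R}(x_n)=\sup\{\varepsilon_J^R(x_{n_k}) : (n_k)\text{ strictly increasing}\}$. *)

theory Defs
  imports "HOL-Analysis.Analysis"
begin

text \<open>
  HOL-Analysis only provides real Banach spaces. A Banach space over a normed field is a type of
  class \<^class>\<open>banach\<close> together with a scalar multiplication that is compatible with the norm and
  with the real scalar multiplication. It is used for the scalar types \<^typ>\<open>real\<close> and
  \<^typ>\<open>complex\<close>; over \<^typ>\<open>real\<close> the only such multiplication is \<^const>\<open>scaleR\<close>.
\<close>

locale banach_space_over = vector_space sm
  for sm :: "'k::real_normed_field \<Rightarrow> 'a::banach \<Rightarrow> 'a" +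
  assumes norm_sm: "norm (sm c x) = norm c * norm x"
    and sm_of_real: "sm (of_real r) x = r *\<^sub>R x"

lemma banach_space_over_scaleR: "banach_space_over (scaleR :: real \<Rightarrow> 'a::banach \<Rightarrow> 'a)"
  by unfold_locales (simp_all add: algebra_simps)

lemma banach_space_over_complex: "banach_space_over ((*) :: complex \<Rightarrow> complex \<Rightarrow> complex)"
  by unfold_locales (simp_all add: algebra_simps norm_mult scaleR_conv_of_real)

text \<open>
  All infima and suprema below are taken in \<^typ>\<open>real\<close>. For a bounded sequence the sets involved
  are nonempty and bounded, so these are the genuine infima and suprema.
\<close>

definition ca :: "(nat \<Rightarrow> 'a::metric_space) \<Rightarrow> real" where
  "ca x = (INF n. diameter (x ` {n..}))"

definition dual_ball ::
    "('k::real_normed_field \<Rightarrow> 'a::real_normed_vector \<Rightarrow> 'a) \<Rightarrow> ('a \<Rightarrow> 'k) set" where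
  "dual_ball sm =
     {f. bounded_linear f \<and> (\<forall>c x. f (sm c x) = c * f x) \<and> onorm f \<le> 1}"

definition delta ::
    "('k::real_normed_field \<Rightarrow> 'a::real_normed_vector \<Rightarrow> 'a) \<Rightarrow> (nat \<Rightarrow> 'a) \<Rightarrow> real" where
  "delta sm x = (SUP f\<in>dual_ball sm. ca (\<lambda>n. f (x n)))"

definition delta_sub ::
    "('k::real_normed_field \<Rightarrow> 'a::real_normed_vector \<Rightarrow> 'a) \<Rightarrow> (nat \<Rightarrow> 'a) \<Rightarrow> real" where
  "delta_sub sm x = (INF r\<in>{r::nat \<Rightarrow> nat. strict_mono r}. delta sm (x \<circ> r))"

definition eps_J ::
    "('k::real_normed_field \<Rightarrow> 'a::real_normed_vector \<Rightarrow> 'a) \<Rightarrow> (nat \<Rightarrow> 'a) \<Rightarrow> real" where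
  "eps_J sm x =
     (SUP n. Inf {norm (\<Sum>k=n..N. sm (\<alpha> k) (x k)) | N \<alpha>.
        n \<le> N \<and> (\<Sum>k=n..N. norm (\<alpha> k)) = 1})"

definition eps_J_sub ::
    "('k::real_normed_field \<Rightarrow> 'a::real_normed_vector \<Rightarrow> 'a) \<Rightarrow> (nat \<Rightarrow> 'a) \<Rightarrow> real" where
  "eps_J_sub sm x = (SUP r\<in>{r::nat \<Rightarrow> nat. strict_mono r}. eps_J sm (x \<circ> r))"

text \<open>The versions with real coefficients, also meaningful in complex spaces.\<close>

definition eps_JR :: "(nat \<Rightarrow> 'a::real_normed_vector) \<Rightarrow> real" where
  "eps_JR x = eps_J scaleR x"

definition eps_JR_sub :: "(nat \<Rightarrow> 'a::real_normed_vector) \<Rightarrow> real" where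
  "eps_JR_sub x = (SUP r\<in>{r::nat \<Rightarrow> nat. strict_mono r}. eps_JR (x \<circ> r))"

end

theory Submission
  imports Defs
begin

text \<open>
  The quantity \<^const>\<open>eps_J\<close> can only grow, and \<^const>\<open>delta\<close> can only shrink, when passing to a
  subsequence, and real coefficients are particular scalars. Hence the lower bounds for
  \<^const>\<open>delta\<close> and \<^const>\<open>delta_sub\<close> all follow from \<open>delta x \<ge> 2 * eps_JR x\<close>. If
  \<open>0 \<le> c < eps_JR x\<close>, then some tail of \<open>x\<close> satisfies
  \<open>c * (\<Sum>\<bar>\<alpha> k\<bar>) \<le> \<parallel>\<Sum>\<alpha> k *\<^sub>R x k\<parallel>\<close>, so the Hahn-Banach theorem yields a real functional of norm
  at most one that maps \<open>x k\<close> to \<open>(-1) ^ k * c\<close> on that tail; its oscillation is \<open>2 * c\<close>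
  (\<open>alternating_functional\<close>). Over the complex numbers it is the real part of a complex-linear
  functional of norm at most one.

  The upper bounds for \<^const>\<open>delta_sub\<close> are a quantitative form of Rosenthal's \<open>\<ell>\<^sub>1\<close> theorem. Let
  \<open>d < delta_sub x\<close>. For every subsequence there are a functional \<open>f\<close> in the dual ball and two
  scalars at distance nearly \<open>d\<close> or more such that \<open>f (x n)\<close> is infinitely often near each of them. Covering the range by
  finitely many small balls makes it possible to pass to a subsequence on which one pair of centres
  \<open>u\<close>, \<open>v\<close> serves for all further subsequences. Thus the sets \<open>A n\<close>, \<open>B n\<close> of functionals \<open>f\<close> with
  \<open>f (x n)\<close> near \<open>u\<close>, respectively near \<open>v\<close>, have no convergent subsequence, and Rosenthal's
  combinatorial dichotomy (\<open>independent_subsequence\<close>) gives a subsequence along which they are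
  independent. Given signs \<open>s k\<close>, choose \<open>f1\<close> in \<open>A k\<close> or \<open>B k\<close> according to \<open>s k\<close>, choose \<open>f2\<close> the
  opposite way, and put \<open>g = (f1 - f2) / 2\<close> and \<open>w = (u - v) / 2\<close>. Then \<open>g\<close> lies in the dual ball
  and \<open>g (x k)\<close> is near \<open>s k * w\<close> (\<open>ex_sign_functionals\<close>), so that
  \<open>\<parallel>\<Sum>\<alpha> k x k\<parallel>\<close> is at least about \<open>\<bar>w\<bar> * \<bar>\<Sum>s k * \<alpha> k\<bar>\<close>, where \<open>\<bar>w\<bar>\<close> is nearly \<open>d / 2\<close> or more.

  Only the choice of the signs depends on the coefficients. Real ones allow
  \<open>\<bar>\<Sum>s k * \<alpha> k\<bar> = \<Sum>\<bar>\<alpha> k\<bar>\<close>, which gives the factor \<open>2\<close>. For complex ones, averaging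
  \<open>\<Sum>\<bar>Im (cis (- \<theta>) * \<alpha> k)\<bar>\<close> over \<open>\<theta>\<close> gives signs with
  \<open>\<bar>\<Sum>s k * \<alpha> k\<bar> \<ge> 2 / pi * (\<Sum>\<bar>\<alpha> k\<bar>)\<close> (\<open>complex_signs\<close>), hence the factor \<open>pi\<close>.
\<close>

section \<open>The Hahn-Banach theorem\<close>

text \<open>
  Sublinear functionals. The inequality \<open>p (t *\<^sub>R y) \<le> t * p y\<close> for \<open>t > 0\<close> implies equality
  (apply it to \<open>inverse t\<close>) and, together with subadditivity, \<open>p 0 = 0\<close>.
\<close>

definition sublinear :: "('a::real_vector \<Rightarrow> real) \<Rightarrow> bool" where
  "sublinear p \<longleftrightarrow> (\<forall>y z. p (y + z) \<le> p y + p z) \<and> (\<forall>t>0. \<forall>y. p (t *\<^sub>R y) \<le> t * p y)"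

lemma sublinear_add: "sublinear p \<Longrightarrow> p (y + z) \<le> p y + p z"
  and sublinear_scaleR_le: "sublinear p \<Longrightarrow> t > 0 \<Longrightarrow> p (t *\<^sub>R y) \<le> t * p y"
  by (simp_all add: sublinear_def)

lemma sublinear_scaleR:
  assumes "sublinear p" "t > 0"
  shows "p (t *\<^sub>R y) = t * p y"
proof (rule antisym)
  show "p (t *\<^sub>R y) \<le> t * p y"
    using assms by (rule sublinear_scaleR_le)
  have "p (inverse t *\<^sub>R (t *\<^sub>R y)) \<le> inverse t * p (t *\<^sub>R y)"
    using assms by (intro sublinear_scaleR_le) auto
  with \<open>t > 0\<close> show "t * p y \<le> p (t *\<^sub>R y)"
    by (simp add: field_simps)
qed

lemma sublinear_zero:
  assumes "sublinear p"
  shows "p 0 = 0"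
  using sublinear_scaleR[OF assms, of 2 0] by simp

lemma sublinear_neg_le:
  assumes "sublinear p"
  shows "- p (- y) \<le> p y"
  using sublinear_add[OF assms, of y "- y"] sublinear_zero[OF assms] by simp

text \<open>
  One closure property covers the three infima needed below: over a chain of sublinear functionals,
  over the translates in a fixed direction, and over a linear subspace.
\<close>

lemma sublinear_INF:
  fixes h :: "'i \<Rightarrow> 'a::real_vector \<Rightarrow> real"
  assumes ne: "I \<noteq> {}" and bdd: "\<And>y. bdd_below ((\<lambda>i. h i y) ` I)"
    and add: "\<And>i j y z. i \<in> I \<Longrightarrow> j \<in> I \<Longrightarrow> \<exists>k\<in>I. h k (y + z) \<le> h i y + h j z"
    and scale: "\<And>i t y. i \<in> I \<Longrightarrow> t > 0 \<Longrightarrow> \<exists>k\<in>I. h k (t *\<^sub>R y) \<le> t * h i y"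
  shows "sublinear (\<lambda>y. INF i\<in>I. h i y)"
  unfolding sublinear_def
proof (intro conjI allI impI)
  fix y z
  have low: "(INF i\<in>I. h i (y + z)) \<le> h i y + h j z" if "i \<in> I" "j \<in> I" for i j
    using add[OF that] cINF_lower[OF bdd] by (meson order_trans)
  have "(INF i\<in>I. h i (y + z)) - h j z \<le> (INF i\<in>I. h i y)" if "j \<in> I" for j
    using low[OF _ that] by (intro cINF_greatest[OF ne]) (simp add: algebra_simps)
  then have "(INF i\<in>I. h i (y + z)) - (INF i\<in>I. h i y) \<le> (INF j\<in>I. h j z)"
    by (intro cINF_greatest[OF ne]) (simp add: algebra_simps)
  then show "(INF i\<in>I. h i (y + z)) \<le> (INF i\<in>I. h i y) + (INF i\<in>I. h i z)"
    by simp
next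
  fix t :: real and y
  assume "t > 0"
  have "(INF i\<in>I. h i (t *\<^sub>R y)) \<le> t * h i y" if "i \<in> I" for i
    using scale[OF that \<open>t > 0\<close>] cINF_lower[OF bdd] by (meson order_trans)
  then have "(INF i\<in>I. h i (t *\<^sub>R y)) / t \<le> (INF i\<in>I. h i y)"
    using \<open>t > 0\<close> by (intro cINF_greatest[OF ne]) (simp add: field_simps)
  then show "(INF i\<in>I. h i (t *\<^sub>R y)) \<le> t * (INF i\<in>I. h i y)"
    using \<open>t > 0\<close> by (simp add: field_simps)
qed

lemma minimal_sublinear_imp_linear:
  fixes q :: "'a::real_vector \<Rightarrow> real"
  assumes q: "sublinear q" and min: "\<And>q'. sublinear q' \<Longrightarrow> (\<forall>y. q' y \<le> q y) \<Longrightarrow> q' = q"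
  shows "linear q"
proof -
  have super: "q y + q a \<le> q (y + a)" for y a
  proof -
    \<comment> \<open>The sublinear functional \<open>INF t. h t\<close> lies below \<open>q\<close>, hence equals \<open>q\<close>; the term for \<open>t = 1\<close>
      then gives superadditivity.\<close>
    define h where "h t z = q (z + t *\<^sub>R a) - t * q a" for t z
    have tq: "q (t *\<^sub>R a) = t * q a" if "t \<ge> 0" for t
      using that sublinear_scaleR[OF q] sublinear_zero[OF q] by (cases "t = 0") auto
    have bdd: "bdd_below ((\<lambda>t. h t z) ` {0..})" for z
    proof (rule bdd_belowI2)
      fix t :: real assume "t \<in> {0..}"
      then show "- q (- z) \<le> h t z"
        using sublinear_add[OF q, of "z + t *\<^sub>R a" "- z"] tq[of t] by (simp add: h_def)
    qed
    have "sublinear (\<lambda>z. INF t\<in>{0..}. h t z)"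
    proof (rule sublinear_INF[OF _ bdd])
      fix i j :: real and y z
      assume "i \<in> {0..}" "j \<in> {0..}"
      then show "\<exists>k\<in>{0..}. h k (y + z) \<le> h i y + h j z"
        using sublinear_add[OF q, of "y + i *\<^sub>R a" "z + j *\<^sub>R a"]
        by (intro bexI[of _ "i + j"]) (auto simp: h_def algebra_simps)
    next
      fix i t :: real and y
      assume "i \<in> {0..}" "t > 0"
      then show "\<exists>k\<in>{0..}. h k (t *\<^sub>R y) \<le> t * h i y"
        using sublinear_scaleR_le[OF q, of t "y + i *\<^sub>R a"]
        by (intro bexI[of _ "t * i"]) (auto simp: h_def algebra_simps)
    qed auto
    moreover have "(INF t\<in>{0..}. h t z) \<le> q z" for z
      using cINF_lower[OF bdd, of 0 z] by (simp add: h_def)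
    ultimately have "(\<lambda>z. INF t\<in>{0..}. h t z) = q"
      using min by blast
    then have "q y \<le> h 1 y"
      using cINF_lower[OF bdd, of 1 y] by (metis atLeast_iff zero_le_one)
    then show ?thesis
      by (simp add: h_def)
  qed
  then have add: "q (y + z) = q y + q z" for y z
    using sublinear_add[OF q, of y z] by (simp add: order_antisym)
  have neg: "q (- y) = - q y" for y
    using add[of y "- y"] sublinear_zero[OF q] by simp
  have "q (t *\<^sub>R y) = t * q y" for t y
  proof (cases t "0::real" rule: linorder_cases)
    case less
    then show ?thesis
      using sublinear_scaleR[OF q, of "- t" y] neg[of "t *\<^sub>R y"] by simp
  qed (simp_all add: sublinear_zero[OF q] sublinear_scaleR[OF q])
  with add show ?thesis
    by (intro linearI) auto
qed

lemma linear_below_sublinear: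
  fixes p :: "'a::real_vector \<Rightarrow> real"
  assumes p: "sublinear p"
  obtains f where "linear f" "\<And>y. f y \<le> p y"
proof -
  define S where "S = {q. sublinear q \<and> (\<forall>y. q y \<le> p y)}"
  define R :: "('a \<Rightarrow> real) \<Rightarrow> ('a \<Rightarrow> real) \<Rightarrow> bool" where "R q q' \<longleftrightarrow> (\<forall>y. q' y \<le> q y)" for q q'
  have "\<exists>m\<in>S. \<forall>q\<in>S. R m q \<longrightarrow> q = m"
  proof (rule predicate_Zorn)
    show "partial_order_on S (relation_of R S)"
      by (rule partial_order_on_relation_ofI) (auto simp: R_def intro: order_trans order_antisym intro!: ext)
  next
    fix C assume C: "C \<in> Chains (relation_of R S)"
    then have CS: "C \<subseteq> S" and chain: "\<And>q q'. q \<in> C \<Longrightarrow> q' \<in> C \<Longrightarrow> R q q' \<or> R q' q"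
      by (auto simp: Chains_def relation_of_def)
    show "\<exists>u\<in>S. \<forall>q\<in>C. R q u"
    proof (cases "C = {}")
      case True
      with p show ?thesis
        by (auto simp: S_def)
    next
      case False
      have bdd: "bdd_below ((\<lambda>q. q y) ` C)" for y
      proof (rule bdd_belowI2)
        fix q assume "q \<in> C"
        with CS show "- p (- y) \<le> q y"
          using sublinear_neg_le[of q y] by (force simp: S_def dest: spec[of _ "- y"])
      qed
      have "sublinear (\<lambda>y. INF q\<in>C. q y)"
      proof (rule sublinear_INF[OF False bdd])
        fix q q' y z
        assume qq': "q \<in> C" "q' \<in> C"
        then have "sublinear q" "sublinear q'"
          using CS by (auto simp: S_def)
        with chain[OF qq'] show "\<exists>k\<in>C. k (y + z) \<le> q y + q' z"
          using qq' sublinear_add[of q y z] sublinear_add[of q' y z]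
          unfolding R_def by (metis add_left_mono add_right_mono order_trans)
      next
        fix q and t :: real and y assume "q \<in> C" "t > 0"
        then show "\<exists>k\<in>C. k (t *\<^sub>R y) \<le> t * q y"
          using CS sublinear_scaleR_le[of q t y] by (intro bexI[of _ q]) (auto simp: S_def)
      qed
      moreover obtain q0 where "q0 \<in> C"
        using False by blast
      moreover have low: "(INF q\<in>C. q y) \<le> q y" if "q \<in> C" for q y
        using that by (rule cINF_lower[OF bdd])
      ultimately have "(\<lambda>y. INF q\<in>C. q y) \<in> S"
        using CS unfolding S_def by (blast intro: order_trans)
      with low show ?thesis
        unfolding R_def by (intro bexI[of _ "\<lambda>y. INF q\<in>C. q y"]) auto
    qed
  qed
  then obtain q where q: "q \<in> S" and min: "\<And>q'. q' \<in> S \<Longrightarrow> R q q' \<Longrightarrow> q' = q"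
    by blast
  have "linear q"
    using q by (intro minimal_sublinear_imp_linear min)
      (auto simp: S_def R_def intro: order_trans)
  with q that show thesis
    by (auto simp: S_def)
qed

text \<open>
  Hahn-Banach extension, with the functional that is to be extended given by its graph \<open>W\<close>. No
  separate argument is needed for \<open>W\<close> to be single-valued: the hypothesis on \<open>W\<close> implies it.
\<close>

lemma Hahn_Banach_graph:
  fixes W :: "('a::real_normed_vector \<times> real) set"
  assumes W: "subspace W" and le: "\<And>w. w \<in> W \<Longrightarrow> snd w \<le> norm (fst w)"
  obtains f where "linear f" "\<And>y. f y \<le> norm y" "\<And>w. w \<in> W \<Longrightarrow> f (fst w) = snd w"
proof -
  \<comment> \<open>A linear \<open>f\<close> below \<open>INF w. h w\<close> lies below the norm (take \<open>w = 0\<close>) and satisfies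
    \<open>f (- fst w) \<le> - snd w\<close> (evaluate at \<open>- fst w\<close>).\<close>
  define h where "h w y = norm (y + fst w) - snd w" for w :: "'a \<times> real" and y
  have bdd: "bdd_below ((\<lambda>w. h w y) ` W)" for y
  proof (rule bdd_belowI2)
    fix w assume "w \<in> W"
    then show "- norm y \<le> h w y"
      using le[of w] norm_triangle_ineq4[of "y + fst w" y] by (simp add: h_def)
  qed
  have "sublinear (\<lambda>y. INF w\<in>W. h w y)"
  proof (rule sublinear_INF[OF _ bdd])
    show "W \<noteq> {}"
      using subspace_0[OF W] by blast
  next
    fix v w y z assume "v \<in> W" "w \<in> W"
    then show "\<exists>k\<in>W. h k (y + z) \<le> h v y + h w z"
      using norm_triangle_ineq[of "y + fst v" "z + fst w"] subspace_add[OF W]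
      by (intro bexI[of _ "v + w"]) (auto simp: h_def algebra_simps)
  next
    fix w y and t :: real assume "w \<in> W" "t > 0"
    moreover have "norm (t *\<^sub>R y + t *\<^sub>R fst w) = t * norm (y + fst w)"
      using \<open>t > 0\<close> by (simp flip: scaleR_add_right)
    ultimately show "\<exists>k\<in>W. h k (t *\<^sub>R y) \<le> t * h w y"
      using subspace_scale[OF W]
      by (intro bexI[of _ "t *\<^sub>R w"]) (auto simp: h_def algebra_simps)
  qed
  then obtain f where f: "linear f" and fle: "\<And>y. f y \<le> (INF w\<in>W. h w y)"
    using linear_below_sublinear by blast
  have fh: "f y \<le> h w y" if "w \<in> W" for w y
    using fle[of y] cINF_lower[OF bdd that, of y] by simp
  have ge: "snd w \<le> f (fst w)" if "w \<in> W" for w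
    using fh[OF that, of "- fst w"] linear_neg[OF f] by (simp add: h_def)
  show thesis
  proof (rule that[OF f])
    show "f y \<le> norm y" for y
      using fh[OF subspace_0[OF W], of y] by (simp add: h_def)
    show "f (fst w) = snd w" if "w \<in> W" for w
      using ge[OF that] ge[OF subspace_neg[OF W that]] linear_neg[OF f] by simp
  qed
qed

section \<open>Rosenthal's dichotomy for sequences of pairs of sets\<close>

text \<open>
  The subsequence of the pairs \<open>(A n, B n)\<close> indexed by \<open>M\<close> converges on \<open>X\<close>: no point of \<open>X\<close> belongs
  both to infinitely many of the \<open>A n\<close> and to infinitely many of the \<open>B n\<close>. The sets \<open>A n\<close> and
  \<open>B n\<close> need not be disjoint.
\<close>

definition convergent_pairs_on ::
    "(nat \<Rightarrow> 'b set) \<Rightarrow> (nat \<Rightarrow> 'b set) \<Rightarrow> nat set \<Rightarrow> 'b set \<Rightarrow> bool" where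
  "convergent_pairs_on A B M X \<longleftrightarrow>
     (\<forall>s\<in>X. finite {n\<in>M. s \<in> A n} \<or> finite {n\<in>M. s \<in> B n})"

text \<open>
  No infinite subset of \<open>M\<close> indexes a subsequence that converges on \<open>X\<close>. If \<open>M\<close> is infinite, this
  forces \<open>X\<close> to be nonempty.
\<close>

definition no_convergent_subseq ::
    "(nat \<Rightarrow> 'b set) \<Rightarrow> (nat \<Rightarrow> 'b set) \<Rightarrow> nat set \<Rightarrow> 'b set \<Rightarrow> bool" where
  "no_convergent_subseq A B M X \<longleftrightarrow>
     (\<forall>M'\<subseteq>M. infinite M' \<longrightarrow> \<not> convergent_pairs_on A B M' X)"

lemma convergent_pairs_on_mono:
  assumes "convergent_pairs_on A B M X" "M' \<subseteq> M"
  shows "convergent_pairs_on A B M' X"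
proof -
  have "finite {n\<in>M'. P n}" if "finite {n\<in>M. P n}" for P
    using that by (rule rev_finite_subset) (use assms in auto)
  then show ?thesis
    using assms by (auto simp: convergent_pairs_on_def)
qed

text \<open>
  The induction step of the dichotomy: a single index \<open>j\<close> splits all the sets of a finite family
  into two parts each of which still admits no convergent subsequence. Otherwise, a diagonal
  argument gives indices \<open>j k\<close> such that, for every \<open>k\<close>, a tail of the diagonal sequence converges on
  \<open>X \<inter> E (j k)\<close> for some \<open>X\<close> in the family and some \<open>E\<close> among \<open>A\<close>, \<open>B\<close>. By the pigeonhole principle
  one pair of \<open>X\<close> and \<open>E\<close> occurs infinitely often. The indices \<open>j k\<close> that carry it form a sequence
  converging on \<open>X\<close>: a point of \<open>X\<close> lies in one of the sets \<open>E (j k)\<close>, or in none of them.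
\<close>

lemma no_convergent_subseq_split:
  assumes M: "infinite M" and fin: "finite \<X>"
    and bad: "\<And>X. X \<in> \<X> \<Longrightarrow> no_convergent_subseq A B M X"
  shows "\<exists>j\<in>M. \<exists>M'\<subseteq>M. infinite M' \<and> (\<forall>m\<in>M'. j < m) \<and>
    (\<forall>X\<in>\<X>. no_convergent_subseq A B M' (X \<inter> A j) \<and> no_convergent_subseq A B M' (X \<inter> B j))"
proof (rule ccontr)
  assume contra: "\<not> ?thesis"
  \<comment> \<open>the labels \<open>(X, E)\<close> that a failing index can carry\<close>
  define \<L> where "\<L> = \<X> \<times> {A, B}"
  define least where "least N = (LEAST n. n \<in> N)" for N :: "nat set"
  have least: "least N \<in> N" if "infinite N" for N
    using that unfolding least_def by (metis LeastI equals0I finite.emptyI)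
  have step: "\<exists>N'. (infinite N' \<and> N' \<subseteq> M) \<and> N' \<subseteq> N \<inter> {least N<..} \<and>
      (\<exists>(X, E)\<in>\<L>. convergent_pairs_on A B N' (X \<inter> E (least N)))"
    if N: "infinite N" "N \<subseteq> M" for N
  proof -
    let ?j = "least N"
    have "N = (N \<inter> {..?j}) \<union> (N \<inter> {?j<..})"
      by auto
    then have "infinite (N \<inter> {?j<..})"
      using N by (metis finite_Int finite_UnI finite_atMost)
    moreover have "?j \<in> M"
      using least N by blast
    ultimately obtain X where "X \<in> \<X>"
      and X: "\<not> (no_convergent_subseq A B (N \<inter> {?j<..}) (X \<inter> A ?j) \<and>
                 no_convergent_subseq A B (N \<inter> {?j<..}) (X \<inter> B ?j))"
      using contra \<open>N \<subseteq> M\<close> by (metis IntD2 greaterThan_iff le_infI1)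
    from X obtain E where "E \<in> {A, B}" "\<not> no_convergent_subseq A B (N \<inter> {?j<..}) (X \<inter> E ?j)"
      by blast
    then obtain N' where "N' \<subseteq> N \<inter> {?j<..}" "infinite N'"
        "convergent_pairs_on A B N' (X \<inter> E ?j)"
      unfolding no_convergent_subseq_def by blast
    then show ?thesis
      using \<open>X \<in> \<X>\<close> \<open>E \<in> {A, B}\<close> \<open>N \<subseteq> M\<close> unfolding \<L>_def
      by (intro exI[of _ N'] conjI bexI[of _ "(X, E)"]) auto
  qed
  have "\<exists>N. \<forall>k. (infinite (N k) \<and> N k \<subseteq> M) \<and> N (Suc k) \<subseteq> N k \<inter> {least (N k)<..} \<and>
      (\<exists>(X, E)\<in>\<L>. convergent_pairs_on A B (N (Suc k)) (X \<inter> E (least (N k))))"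
    by (rule dependent_nat_choice) (use M step in auto)
  then obtain N where N: "\<And>k. infinite (N k)" "\<And>k. N k \<subseteq> M"
    and NSuc: "\<And>k. N (Suc k) \<subseteq> N k \<inter> {least (N k)<..}"
    and "\<And>k. \<exists>(X, E)\<in>\<L>. convergent_pairs_on A B (N (Suc k)) (X \<inter> E (least (N k)))"
    by blast
  then have "\<forall>k. \<exists>l. l \<in> \<L> \<and>
      convergent_pairs_on A B (N (Suc k)) (fst l \<inter> snd l (least (N k)))"
    by (fastforce simp: case_prod_beta)
  from choice[OF this] obtain L where L: "\<And>k. L k \<in> \<L>"
    and conv: "\<And>k. convergent_pairs_on A B (N (Suc k)) (fst (L k) \<inter> snd (L k) (least (N k)))"
    by blast
  define j where "j k = least (N k)" for k
  have anti: "N m \<subseteq> N k" if "k \<le> m" for k m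
    by (rule lift_Suc_antimono_le[OF _ that]) (use NSuc in blast)
  have jN: "j m \<in> N k" if "k \<le> m" for k m
    using least[OF N(1), of m] anti[OF that] unfolding j_def by blast
  have "j k < j (Suc k)" for k
    using jN[of "Suc k" "Suc k"] NSuc[of k] unfolding j_def by blast
  then have mono: "strict_mono j"
    by (simp add: strict_mono_Suc_iff)
  have "finite \<L>"
    using fin by (simp add: \<L>_def)
  then have "\<exists>l\<in>\<L>. infinite {k \<in> UNIV. L k = l}"
    using L by (intro pigeonhole_infinite_rel) auto
  then obtain X E where XE: "(X, E) \<in> \<L>" and K: "infinite {k. L k = (X, E)}"
    by auto
  define J where "J = j ` {k. L k = (X, E)}"
  have "infinite J"
    using K mono unfolding J_def by (metis finite_imageD strict_mono_imp_inj_on inj_on_subset subset_UNIV)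
  moreover have "J \<subseteq> M"
    using jN[of 0] N(2)[of 0] unfolding J_def by blast
  moreover have "convergent_pairs_on A B J X"
    unfolding convergent_pairs_on_def
  proof
    fix s assume "s \<in> X"
    show "finite {n \<in> J. s \<in> A n} \<or> finite {n \<in> J. s \<in> B n}"
    proof (cases "\<exists>k. L k = (X, E) \<and> s \<in> E (j k)")
      case True
      then obtain k where k: "L k = (X, E)" "s \<in> E (j k)"
        by blast
      have "J \<subseteq> j ` {..k} \<union> N (Suc k)"
        using jN[of "Suc k"] unfolding J_def by (metis (lifting) UnI1 UnI2 atMost_iff image_eqI image_subsetI not_less_eq_eq)
      then have "{n \<in> J. P n} \<subseteq> j ` {..k} \<union> {n \<in> N (Suc k). P n}" for P
        by blast
      then have fin_J: "finite {n \<in> J. P n}" if "finite {n \<in> N (Suc k). P n}" for P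
        using that by (meson finite_UnI finite_atMost finite_imageI finite_subset)
      have "finite {n \<in> N (Suc k). s \<in> A n} \<or> finite {n \<in> N (Suc k). s \<in> B n}"
        using conv[of k] k \<open>s \<in> X\<close> by (auto simp: convergent_pairs_on_def j_def)
      then show ?thesis
        using fin_J[of "\<lambda>n. s \<in> A n"] fin_J[of "\<lambda>n. s \<in> B n"] by blast
    next
      case False
      then have "{n \<in> J. s \<in> E n} = {}"
        by (auto simp: J_def)
      then have "finite {n \<in> J. s \<in> E n}"
        by (metis finite.emptyI)
      moreover have "E = A \<or> E = B"
        using XE by (auto simp: \<L>_def)
      ultimately show ?thesis
        by blast
    qed
  qed
  moreover have "X \<in> \<X>"
    using XE by (simp add: \<L>_def)
  ultimately show False
    using bad by (auto simp: no_convergent_subseq_def)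
qed

text \<open>
  Rosenthal's combinatorial theorem. The Boolean independence is stated through the initial segments
  of a subsequence: all \<open>2 ^ n\<close> cells formed by its first \<open>n\<close> pairs are nonempty in \<open>S\<close>.
\<close>

lemma independent_subsequence:
  assumes M: "infinite M" and bad: "no_convergent_subseq A B M S"
  shows "\<exists>r::nat \<Rightarrow> nat. strict_mono r \<and> range r \<subseteq> M \<and>
    (\<forall>n \<sigma>. S \<inter> (\<Inter>k<n. if \<sigma> k then A (r k) else B (r k)) \<noteq> {})"
proof -
  \<comment> \<open>States consist of an index set and the family of the cells formed so far.\<close>
  define good where "good = (\<lambda>(N, \<X>). infinite N \<and> N \<subseteq> M \<and> finite \<X> \<and>
    (\<forall>X\<in>\<X>. no_convergent_subseq A B N X))"
  define succ where "succ = (\<lambda>(N, \<X>) (N', \<X>'). \<exists>j\<in>N. N' \<subseteq> N \<and> (\<forall>m\<in>N'. j < m) \<and>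
    \<X>' = (\<lambda>X. X \<inter> A j) ` \<X> \<union> (\<lambda>X. X \<inter> B j) ` \<X>)"
  have "\<exists>F. \<forall>n. (good (F n) \<and> (n = 0 \<longrightarrow> F n = (M, {S}))) \<and> succ (F n) (F (Suc n))"
  proof (rule dependent_nat_choice)
    show "\<exists>N\<X>. good N\<X> \<and> (0 = (0::nat) \<longrightarrow> N\<X> = (M, {S}))"
      using M bad by (auto simp: good_def)
  next
    fix N\<X> and n :: nat assume *: "good N\<X> \<and> (n = 0 \<longrightarrow> N\<X> = (M, {S}))"
    obtain N \<X> where N\<X>: "N\<X> = (N, \<X>)"
      by force
    with * obtain j N' where "j \<in> N" "N' \<subseteq> N" "infinite N'" "\<forall>m\<in>N'. j < m"
      "\<forall>X\<in>\<X>. no_convergent_subseq A B N' (X \<inter> A j) \<and> no_convergent_subseq A B N' (X \<inter> B j)"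
      using no_convergent_subseq_split[of N \<X> A B] by (auto simp: good_def)
    with * show "\<exists>N\<X>'. (good N\<X>' \<and> (Suc n = 0 \<longrightarrow> N\<X>' = (M, {S}))) \<and> succ N\<X> N\<X>'"
      unfolding N\<X>
      by (intro exI[of _ "(N', (\<lambda>X. X \<inter> A j) ` \<X> \<union> (\<lambda>X. X \<inter> B j) ` \<X>)"])
        (auto simp: good_def succ_def)
  qed
  then obtain F where good: "\<And>n. good (F n)" and F0: "F 0 = (M, {S})"
    and succ: "\<And>n. succ (F n) (F (Suc n))"
    by blast
  have "\<forall>n. \<exists>j. j \<in> fst (F n) \<and> fst (F (Suc n)) \<subseteq> fst (F n) \<and> (\<forall>m\<in>fst (F (Suc n)). j < m) \<and>
      snd (F (Suc n)) = (\<lambda>X. X \<inter> A j) ` snd (F n) \<union> (\<lambda>X. X \<inter> B j) ` snd (F n)"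
    using succ by (fastforce simp: succ_def case_prod_beta)
  then obtain r where r: "\<And>n. r n \<in> fst (F n)"
    and rless: "\<And>n. \<forall>m\<in>fst (F (Suc n)). r n < m"
    and snd_F: "\<And>n. snd (F (Suc n)) = (\<lambda>X. X \<inter> A (r n)) ` snd (F n) \<union> (\<lambda>X. X \<inter> B (r n)) ` snd (F n)"
    by metis
  have cells: "S \<inter> (\<Inter>k<n. if \<sigma> k then A (r k) else B (r k)) \<in> snd (F n)" for n \<sigma>
  proof (induction n)
    case 0
    then show ?case by (simp add: F0)
  next
    case (Suc n)
    have "S \<inter> (\<Inter>k<Suc n. if \<sigma> k then A (r k) else B (r k)) =
        (S \<inter> (\<Inter>k<n. if \<sigma> k then A (r k) else B (r k))) \<inter> (if \<sigma> n then A (r n) else B (r n))"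
      unfolding lessThan_Suc by blast
    with Suc show ?case
      unfolding snd_F by auto
  qed
  show ?thesis
  proof (intro exI[of _ r] conjI allI)
    show "strict_mono r"
      using r rless by (auto simp: strict_mono_Suc_iff)
    show "range r \<subseteq> M"
      using r good by (fastforce simp: good_def case_prod_beta)
    show "S \<inter> (\<Inter>k<n. if \<sigma> k then A (r k) else B (r k)) \<noteq> {}" for n \<sigma>
    proof
      assume "S \<inter> (\<Inter>k<n. if \<sigma> k then A (r k) else B (r k)) = {}"
      then have "no_convergent_subseq A B (fst (F n)) {}" "infinite (fst (F n))"
        using cells[of \<sigma> n] good[of n] by (auto simp: good_def case_prod_beta)
      then show False
        by (auto simp: no_convergent_subseq_def convergent_pairs_on_def)
    qed
  qed
qed

text \<open>
  If on every subsequence at least one of finitely many sequences of pairs diverges, then one of them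
  diverges on all further subsequences of some subsequence.
\<close>

lemma ex_no_convergent_subseq:
  assumes "finite I"
    and div: "\<And>M. infinite M \<Longrightarrow> \<exists>i\<in>I. \<not> convergent_pairs_on (A i) (B i) M S"
  shows "\<exists>i\<in>I. \<exists>M. infinite M \<and> no_convergent_subseq (A i) (B i) M S"
proof (rule ccontr)
  assume contra: "\<not> ?thesis"
  have "\<exists>M. infinite M \<and> (\<forall>i\<in>J. convergent_pairs_on (A i) (B i) M S)" if "J \<subseteq> I" for J
    using finite_subset[OF that \<open>finite I\<close>] that
  proof (induction J rule: finite_induct)
    case empty
    show ?case by auto
  next
    case (insert i J)
    then obtain M where M: "infinite M" "\<forall>i\<in>J. convergent_pairs_on (A i) (B i) M S"
      by auto
    moreover have "\<not> no_convergent_subseq (A i) (B i) M S"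
      using contra M insert.prems by auto
    ultimately obtain M' where M': "M' \<subseteq> M" "infinite M'" "convergent_pairs_on (A i) (B i) M' S"
      by (auto simp: no_convergent_subseq_def)
    have "convergent_pairs_on (A j) (B j) M' S" if "j \<in> J" for j
      using convergent_pairs_on_mono M M' that by metis
    with M' show ?case
      by blast
  qed
  with div show False
    by blast
qed

section \<open>The dual ball and the quantities under consideration\<close>

lemma norm_le_of_dual_ball:
  assumes "f \<in> dual_ball sm"
  shows "norm (f y) \<le> norm y"
proof -
  have "norm (f y) \<le> onorm f * norm y"
    using assms by (intro onorm) (auto simp: dual_ball_def)
  also have "\<dots> \<le> 1 * norm y"
    using assms by (intro mult_right_mono) (auto simp: dual_ball_def)
  finally show ?thesis by simp
qed

lemma dual_ball_add: "f \<in> dual_ball sm \<Longrightarrow> f (y + z) = f y + f z"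
  and dual_ball_diff: "f \<in> dual_ball sm \<Longrightarrow> f (y - z) = f y - f z"
  and dual_ball_sum: "f \<in> dual_ball sm \<Longrightarrow> f (\<Sum>i\<in>I. g i) = (\<Sum>i\<in>I. f (g i))"
  and dual_ball_sm: "f \<in> dual_ball sm \<Longrightarrow> f (sm c y) = c * f y"
  by (auto simp: dual_ball_def linear_add linear_diff linear_sum bounded_linear.linear)

lemma (in banach_space_over) dual_ballI:
  assumes "\<And>y z. f (y + z) = f y + f z" "\<And>c y. f (sm c y) = c * f y"
    and "\<And>y. norm (f y) \<le> norm y"
  shows "f \<in> dual_ball sm"
proof -
  have "f (r *\<^sub>R y) = r *\<^sub>R f y" for r y
    using assms(2)[of "of_real r" y] by (simp add: sm_of_real scaleR_conv_of_real)
  then have "bounded_linear f"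
    using assms by (intro bounded_linear_intro[of _ 1]) auto
  moreover have "onorm f \<le> 1"
    using assms(3) by (intro onorm_bound) auto
  ultimately show ?thesis
    using assms(2) by (simp add: dual_ball_def)
qed

lemma (in banach_space_over) zero_mem_dual_ball: "(\<lambda>_. 0) \<in> dual_ball sm"
  by (intro dual_ballI) auto

lemma bounded_range_compose:
  assumes "bounded (range x)"
  shows "bounded (range (x \<circ> r))"
  using assms by (rule bounded_subset) auto

lemma bounded_dual_ball_image:
  assumes "f \<in> dual_ball sm" "bounded (range x)"
  shows "bounded (range (\<lambda>n. f (x n)))"
proof -
  obtain C where "\<And>n. norm (x n) \<le> C"
    using assms(2) by (auto simp: bounded_iff)
  then have "norm (f (x n)) \<le> C" for n
    using norm_le_of_dual_ball[OF assms(1), of "x n"] by (rule order_trans[rotated])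
  then show ?thesis
    by (auto simp: bounded_iff)
qed

lemma diameter_tail_nonneg: "bounded (range y) \<Longrightarrow> 0 \<le> diameter (y ` {n..})"
  by (intro diameter_ge_0) (auto intro: bounded_subset)

lemma bdd_below_tail_diameters: "bdd_below (range (\<lambda>n. diameter (y ` {n..})))"
  if "bounded (range y)" for y :: "nat \<Rightarrow> 'a::metric_space"
  using diameter_tail_nonneg[OF that] by (intro bdd_belowI2[of _ 0])

lemma ca_nonneg:
  assumes "bounded (range y)"
  shows "0 \<le> ca y"
  unfolding ca_def using diameter_tail_nonneg[OF assms] by (intro cINF_greatest) auto

lemma ca_le:
  fixes y :: "nat \<Rightarrow> 'a::real_normed_vector"
  assumes "\<And>n. norm (y n) \<le> C"
  shows "ca y \<le> 2 * C"
proof -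
  have bdd: "bounded (range y)"
    using assms by (auto simp: bounded_iff)
  have "ca y \<le> diameter (y ` {0..})"
    unfolding ca_def by (rule cINF_lower[OF bdd_below_tail_diameters[OF bdd]]) auto
  also have "\<dots> \<le> 2 * C"
  proof (rule diameter_le)
    fix u v assume "u \<in> y ` {0..}" "v \<in> y ` {0..}"
    then show "norm (u - v) \<le> 2 * C"
      using assms norm_triangle_ineq4[of u v] by (smt (verit) imageE)
  qed auto
  finally show ?thesis .
qed

lemma ca_greatest:
  assumes "bounded (range y)" "\<And>n. \<exists>k\<ge>n. \<exists>l\<ge>n. c \<le> dist (y k) (y l)"
  shows "c \<le> ca y"
  unfolding ca_def
proof (rule cINF_greatest)
  fix n
  obtain k l where "k \<ge> n" "l \<ge> n" and c: "c \<le> dist (y k) (y l)"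
    using assms(2) by blast
  then have "dist (y k) (y l) \<le> diameter (y ` {n..})"
    using assms(1) by (intro diameter_bounded_bound) (auto intro: bounded_subset[of "range y"])
  with c show "c \<le> diameter (y ` {n..})"
    by simp
qed auto

lemma less_caD:
  fixes y :: "nat \<Rightarrow> 'a::real_normed_vector"
  assumes "c < ca y" "bounded (range y)"
  obtains k l where "k \<ge> n" "l \<ge> n" "c < dist (y k) (y l)"
proof -
  have "c < diameter (y ` {n..})"
    using assms(1) cINF_lower[OF bdd_below_tail_diameters[OF assms(2)], of n] by (simp add: ca_def)
  then have "\<exists>u\<in>y ` {n..}. \<exists>v\<in>y ` {n..}. c < norm (u - v)"
    using diameter_le[of "y ` {n..}" c] by (force simp: not_le[symmetric])
  then show thesis
    using that by (auto simp: dist_norm)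
qed

lemma ca_subseq_le:
  fixes y :: "nat \<Rightarrow> 'a::real_normed_vector"
  assumes "bounded (range y)" "strict_mono r"
  shows "ca (y \<circ> r) \<le> ca y"
proof (rule dense_le)
  fix c assume c: "c < ca (y \<circ> r)"
  show "c \<le> ca y"
  proof (rule ca_greatest[OF assms(1)])
    fix n
    obtain k l where "k \<ge> n" "l \<ge> n" "c < dist ((y \<circ> r) k) ((y \<circ> r) l)"
      using less_caD[OF c bounded_range_compose[OF assms(1)]] by blast
    moreover have "k \<le> r k" "l \<le> r l"
      using seq_suble[OF assms(2)] by auto
    ultimately show "\<exists>k\<ge>n. \<exists>l\<ge>n. c \<le> dist (y k) (y l)"
      by (intro exI[of _ "r k"] exI[of _ "r l"] conjI) auto
  qed
qed

context banach_space_over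
begin

lemma bdd_above_ca_dual_ball:
  assumes "bounded (range x)"
  shows "bdd_above ((\<lambda>f. ca (\<lambda>n. f (x n))) ` dual_ball sm)"
proof -
  obtain C where C: "\<And>n. norm (x n) \<le> C"
    using assms by (auto simp: bounded_iff)
  show ?thesis
  proof (rule bdd_aboveI2)
    fix f assume f: "f \<in> dual_ball sm"
    show "ca (\<lambda>n. f (x n)) \<le> 2 * C"
      by (rule ca_le) (use norm_le_of_dual_ball[OF f] C in \<open>auto intro: order_trans\<close>)
  qed
qed

lemma ca_le_delta:
  assumes "bounded (range x)" "f \<in> dual_ball sm"
  shows "ca (\<lambda>n. f (x n)) \<le> delta sm x"
  unfolding delta_def using bdd_above_ca_dual_ball[OF assms(1)] assms(2) by (rule cSUP_upper2) simp

lemma delta_nonneg: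
  assumes "bounded (range x)"
  shows "0 \<le> delta sm x"
  using ca_le_delta[OF assms zero_mem_dual_ball] ca_nonneg[of "\<lambda>_. 0 :: 'k"] by simp

lemma less_deltaD:
  assumes "c < delta sm x"
  obtains f where "f \<in> dual_ball sm" "c < ca (\<lambda>n. f (x n))"
proof (rule less_cSupE[OF assms[unfolded delta_def]])
  show "(\<lambda>f. ca (\<lambda>n. f (x n))) ` dual_ball sm \<noteq> {}"
    using zero_mem_dual_ball by blast
qed (use that in blast)

lemma delta_subseq_le:
  assumes "bounded (range x)" "strict_mono r"
  shows "delta sm (x \<circ> r) \<le> delta sm x"
proof (rule dense_le)
  fix c assume "c < delta sm (x \<circ> r)"
  then obtain f where f: "f \<in> dual_ball sm" and c: "c < ca ((\<lambda>n. f (x n)) \<circ> r)"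
    by (auto elim!: less_deltaD simp: o_def)
  note c
  also have "ca ((\<lambda>n. f (x n)) \<circ> r) \<le> ca (\<lambda>n. f (x n))"
    using bounded_dual_ball_image[OF f assms(1)] assms(2) by (rule ca_subseq_le)
  also have "\<dots> \<le> delta sm x"
    using assms(1) f by (rule ca_le_delta)
  finally show "c \<le> delta sm x"
    by simp
qed

lemma delta_sub_le:
  assumes "bounded (range x)" "strict_mono r"
  shows "delta_sub sm x \<le> delta sm (x \<circ> r)"
  unfolding delta_sub_def
  using assms delta_nonneg[OF bounded_range_compose] 
  by (intro cINF_lower bdd_belowI2[of _ 0]) auto

lemma delta_sub_greatest:
  assumes "\<And>r. strict_mono r \<Longrightarrow> c \<le> delta sm (x \<circ> r)"
  shows "c \<le> delta_sub sm x"
  unfolding delta_sub_def using assms strict_mono_id by (intro cINF_greatest) auto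

text \<open>
  The infimum in the definition of \<^const>\<open>eps_J\<close>: the best constant in the lower \<open>\<ell>\<^sub>1\<close> estimate for
  the tail of \<open>x\<close> that starts at \<open>n\<close>.
\<close>

definition lower_l1 :: "(nat \<Rightarrow> 'a) \<Rightarrow> nat \<Rightarrow> real" where
  "lower_l1 x n = Inf {norm (\<Sum>k=n..N. sm (\<alpha> k) (x k)) | N \<alpha>.
        n \<le> N \<and> (\<Sum>k=n..N. norm (\<alpha> k)) = 1}"

lemma lower_l1_le:
  assumes "n \<le> N" "(\<Sum>k=n..N. norm (\<alpha> k)) = 1"
  shows "lower_l1 x n \<le> norm (\<Sum>k=n..N. sm (\<alpha> k) (x k))"
  unfolding lower_l1_def using assms by (intro cInf_lower bdd_belowI[of _ 0]) auto

lemma lower_l1_le_norm: "lower_l1 x n \<le> norm (x n)"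
  using lower_l1_le[of n n "\<lambda>_. 1" x] by simp

lemma lower_l1_greatest:
  fixes x :: "nat \<Rightarrow> 'a"
  assumes "\<And>N \<alpha>. n \<le> N \<Longrightarrow> (\<Sum>k=n..N. norm (\<alpha> k)) = 1 \<Longrightarrow>
    c \<le> norm (\<Sum>k=n..N. sm (\<alpha> k) (x k))"
  shows "c \<le> lower_l1 x n"
  unfolding lower_l1_def
proof (rule cInf_greatest)
  have "norm (x n) \<in> {norm (\<Sum>k=n..N. sm (\<alpha> k) (x k)) | N \<alpha>. n \<le> N \<and> (\<Sum>k=n..N. norm (\<alpha> k)) = 1}"
    by (rule CollectI, rule exI[of _ n], rule exI[of _ "\<lambda>_. 1"]) simp
  then show "{norm (\<Sum>k=n..N. sm (\<alpha> k) (x k)) | N \<alpha>. n \<le> N \<and> (\<Sum>k=n..N. norm (\<alpha> k)) = 1} \<noteq> {}"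
    by blast
qed (use assms in auto)

lemma eps_J_eq: "eps_J sm x = (SUP n. lower_l1 x n)"
  by (simp add: eps_J_def lower_l1_def)

lemma bdd_above_lower_l1:
  assumes "\<And>n. norm (x n) \<le> C"
  shows "bdd_above (range (lower_l1 x))"
  using order_trans[OF lower_l1_le_norm assms] by (rule bdd_aboveI2)

lemma eps_J_le:
  assumes "\<And>n. norm (x n) \<le> C"
  shows "eps_J sm x \<le> C"
  unfolding eps_J_eq using order_trans[OF lower_l1_le_norm assms] by (intro cSUP_least) auto

lemma eps_J_greatest:
  assumes "bounded (range x)"
    and "\<And>N \<alpha>. n \<le> N \<Longrightarrow> (\<Sum>k=n..N. norm (\<alpha> k)) = 1 \<Longrightarrow>
      c \<le> norm (\<Sum>k=n..N. sm (\<alpha> k) (x k))"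
  shows "c \<le> eps_J sm x"
proof -
  obtain C where C: "\<And>n. norm (x n) \<le> C"
    using assms(1) by (auto simp: bounded_iff)
  have "c \<le> lower_l1 x n"
    using assms(2) by (rule lower_l1_greatest)
  also have "\<dots> \<le> eps_J sm x"
    unfolding eps_J_eq using C by (intro cSUP_upper bdd_above_lower_l1) auto
  finally show ?thesis .
qed

lemma less_eps_JD:
  assumes "c < eps_J sm x"
  shows "\<exists>n. \<forall>N\<ge>n. \<forall>\<alpha>. (\<Sum>k=n..N. norm (\<alpha> k)) = 1 \<longrightarrow> c \<le> norm (\<Sum>k=n..N. sm (\<alpha> k) (x k))"
proof -
  obtain n where n: "c < lower_l1 x n"
    using assms unfolding eps_J_eq by (auto elim: less_cSupE)
  show ?thesis
    using order_trans[OF less_imp_le[OF n] lower_l1_le] by blast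
qed

lemma eps_J_le_subseq:
  assumes "bounded (range x)" "strict_mono r"
  shows "eps_J sm x \<le> eps_J sm (x \<circ> r)"
proof (rule dense_le)
  fix c assume "c < eps_J sm x"
  then obtain n where n: "\<And>N \<alpha>. n \<le> N \<Longrightarrow> (\<Sum>k=n..N. norm (\<alpha> k)) = 1 \<Longrightarrow>
      c \<le> norm (\<Sum>k=n..N. sm (\<alpha> k) (x k))"
    using less_eps_JD[of c x] by blast
  show "c \<le> eps_J sm (x \<circ> r)"
  proof (rule eps_J_greatest[OF bounded_range_compose[OF assms(1)]])
    fix N and \<alpha> :: "nat \<Rightarrow> 'k" assume "n \<le> N" and 1: "(\<Sum>k=n..N. norm (\<alpha> k)) = 1"
    have inj: "inj_on r {n..N}"
      using assms(2) by (meson inj_on_subset strict_mono_imp_inj_on subset_UNIV)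
    have sub: "r ` {n..N} \<subseteq> {n..r N}"
      using seq_suble[OF assms(2)] strict_mono_less_eq[OF assms(2)] by (force intro: order_trans)
    \<comment> \<open>A combination of the subsequence is one of \<open>x\<close>, with zero coefficients off the range of \<open>r\<close>.\<close>
    define \<beta> where "\<beta> j = (if j \<in> r ` {n..N} then \<alpha> (inv_into {n..N} r j) else 0)" for j
    have \<beta>: "\<beta> (r k) = \<alpha> k" if "k \<in> {n..N}" for k
      using that inj by (simp add: \<beta>_def)
    have reindex: "(\<Sum>j=n..r N. g j) = (\<Sum>k=n..N. g (r k))"
      if "\<And>j. j \<notin> r ` {n..N} \<Longrightarrow> g j = 0" for g :: "nat \<Rightarrow> 'c::comm_monoid_add"
    proof -
      have "(\<Sum>j=n..r N. g j) = (\<Sum>j\<in>r ` {n..N}. g j)"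
        using sub that by (intro sum.mono_neutral_right) auto
      then show ?thesis
        using inj by (simp add: sum.reindex)
    qed
    have "(\<Sum>j=n..r N. norm (\<beta> j)) = (\<Sum>k=n..N. norm (\<alpha> k))"
      by (subst reindex) (auto simp: \<beta>, auto simp: \<beta>_def)
    moreover have "(\<Sum>j=n..r N. sm (\<beta> j) (x j)) = (\<Sum>k=n..N. sm (\<alpha> k) (x (r k)))"
      by (subst reindex) (auto simp: \<beta>, auto simp: \<beta>_def)
    moreover have "n \<le> r N"
      using \<open>n \<le> N\<close> seq_suble[OF assms(2), of N] by simp
    ultimately show "c \<le> norm (\<Sum>k=n..N. sm (\<alpha> k) ((x \<circ> r) k))"
      using n[of "r N" \<beta>] 1 by simp
  qed
qed

lemma eps_J_le_eps_JR:
  assumes "bounded (range x)"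
  shows "eps_J sm x \<le> eps_JR x"
proof (rule dense_le)
  interpret R: banach_space_over "scaleR :: real \<Rightarrow> 'a \<Rightarrow> 'a"
    by (rule banach_space_over_scaleR)
  fix c assume "c < eps_J sm x"
  then obtain n where n: "\<And>N \<alpha>. n \<le> N \<Longrightarrow> (\<Sum>k=n..N. norm (\<alpha> k)) = 1 \<Longrightarrow>
      c \<le> norm (\<Sum>k=n..N. sm (\<alpha> k) (x k))"
    using less_eps_JD[of c x] by blast
  show "c \<le> eps_JR x"
    unfolding eps_JR_def
  proof (rule R.eps_J_greatest[OF assms])
    fix N and \<alpha> :: "nat \<Rightarrow> real" assume "n \<le> N" "(\<Sum>k=n..N. norm (\<alpha> k)) = 1"
    then show "c \<le> norm (\<Sum>k=n..N. \<alpha> k *\<^sub>R x k)"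
      using n[of N "\<lambda>k. of_real (\<alpha> k)"] by (simp add: sm_of_real)
  qed
qed

lemma eps_J_le_eps_J_sub:
  assumes "bounded (range x)" "strict_mono r"
  shows "eps_J sm (x \<circ> r) \<le> eps_J_sub sm x"
proof -
  obtain C where C: "\<And>n. norm (x n) \<le> C"
    using assms(1) by (auto simp: bounded_iff)
  show ?thesis
    unfolding eps_J_sub_def using assms(2) C
    by (intro cSUP_upper bdd_aboveI2[of _ _ C] eps_J_le) auto
qed

lemma eps_J_sub_least:
  assumes "\<And>r. strict_mono r \<Longrightarrow> eps_J sm (x \<circ> r) \<le> c"
  shows "eps_J_sub sm x \<le> c"
  unfolding eps_J_sub_def using assms strict_mono_id by (intro cSUP_least) auto

end

lemma eps_JR_sub_eq: "eps_JR_sub x = eps_J_sub scaleR x"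
  by (simp add: eps_JR_sub_def eps_J_sub_def eps_JR_def)

lemma (in banach_space_over) eps_J_sub_le_eps_JR_sub:
  assumes "bounded (range x)"
  shows "eps_J_sub sm x \<le> eps_JR_sub x"
proof -
  interpret R: banach_space_over "scaleR :: real \<Rightarrow> 'a \<Rightarrow> 'a"
    by (rule banach_space_over_scaleR)
  show ?thesis
    unfolding eps_JR_sub_eq
    by (rule eps_J_sub_least)
      (metis R.eps_J_le_eps_J_sub assms bounded_range_compose eps_JR_def eps_J_le_eps_JR order_trans)
qed

section \<open>Lower bounds for the oscillation\<close>

lemma span_image_nat_eq_interval_sum:
  fixes p :: "nat \<Rightarrow> 'b::real_vector"
  assumes "w \<in> span (p ` {n..})"
  obtains N \<alpha> where "n \<le> N" "w = (\<Sum>k=n..N. \<alpha> k *\<^sub>R p k)"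
proof -
  obtain t \<beta> where "finite t" "t \<subseteq> p ` {n..}" and w: "w = (\<Sum>a\<in>t. \<beta> a *\<^sub>R a)"
    using assms unfolding span_explicit by blast
  then obtain K where K: "K \<subseteq> {n..}" "inj_on p K" "t = p ` K"
    unfolding subset_image_inj by blast
  with \<open>finite t\<close> have "finite K"
    using finite_imageD by blast
  define N where "N = Max (insert n K)"
  have KN: "K \<subseteq> {n..N}"
    using K \<open>finite K\<close> by (auto simp: N_def)
  have "w = (\<Sum>k\<in>K. \<beta> (p k) *\<^sub>R p k)"
    using K by (simp add: w sum.reindex)
  also have "\<dots> = (\<Sum>k=n..N. (if k \<in> K then \<beta> (p k) else 0) *\<^sub>R p k)"
    using KN by (intro sum.mono_neutral_cong_left) auto
  finally show thesis
    using that[of N "\<lambda>k. if k \<in> K then \<beta> (p k) else 0"] \<open>finite K\<close> by (simp add: N_def)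
qed

lemma alternating_functional:
  fixes x :: "nat \<Rightarrow> 'a::banach"
  assumes c: "c < eps_JR x" "0 \<le> c"
  obtains f n where "linear f" "\<And>y. f y \<le> norm y" "\<And>k. k \<ge> n \<Longrightarrow> f (x k) = (-1) ^ k * c"
proof -
  interpret banach_space_over "scaleR :: real \<Rightarrow> 'a \<Rightarrow> 'a"
    by (rule banach_space_over_scaleR)
  obtain n where n: "\<And>N \<alpha>. n \<le> N \<Longrightarrow> (\<Sum>k=n..N. \<bar>\<alpha> k\<bar>) = 1 \<Longrightarrow> c \<le> norm (\<Sum>k=n..N. \<alpha> k *\<^sub>R x k)"
    using less_eps_JD[of c x] c by (auto simp: eps_JR_def)
  have homog: "c * (\<Sum>k=n..N. \<bar>\<alpha> k\<bar>) \<le> norm (\<Sum>k=n..N. \<alpha> k *\<^sub>R x k)" if "n \<le> N" for N \<alpha>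
  proof (cases "(\<Sum>k=n..N. \<bar>\<alpha> k\<bar>) = 0")
    case False
    define A where "A = (\<Sum>k=n..N. \<bar>\<alpha> k\<bar>)"
    have "A > 0"
      using False by (simp add: A_def less_le sum_nonneg)
    have "(\<Sum>k=n..N. \<bar>\<alpha> k / A\<bar>) = 1"
      using \<open>A > 0\<close> by (simp add: A_def[symmetric] flip: sum_divide_distrib)
    then have "c \<le> norm (\<Sum>k=n..N. (\<alpha> k / A) *\<^sub>R x k)"
      using n[OF that, of "\<lambda>k. \<alpha> k / A"] by simp
    also have "(\<Sum>k=n..N. (\<alpha> k / A) *\<^sub>R x k) = (1 / A) *\<^sub>R (\<Sum>k=n..N. \<alpha> k *\<^sub>R x k)"
      by (simp add: scaleR_sum_right divide_inverse mult.commute)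
    also have "norm \<dots> = norm (\<Sum>k=n..N. \<alpha> k *\<^sub>R x k) / A"
      using \<open>A > 0\<close> by simp
    finally show ?thesis
      using \<open>A > 0\<close> by (simp add: A_def[symmetric] pos_le_divide_eq)
  qed simp
  \<comment> \<open>The graph of the functional to be extended is the span of the points \<open>p k\<close>.\<close>
  define p where "p k = (x k, (-1) ^ k * c)" for k :: nat
  have le: "snd w \<le> norm (fst w)" if w: "w \<in> span (p ` {n..})" for w
  proof -
    obtain N \<alpha> where "n \<le> N" and w: "w = (\<Sum>k=n..N. \<alpha> k *\<^sub>R p k)"
      using w by (rule span_image_nat_eq_interval_sum)
    have "snd w = (\<Sum>k=n..N. \<alpha> k * ((-1) ^ k * c))"
      by (simp add: w p_def snd_sum)
    also have "\<dots> \<le> (\<Sum>k=n..N. c * \<bar>\<alpha> k\<bar>)"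
    proof (rule sum_mono)
      fix k
      have "\<alpha> k * ((-1) ^ k * c) \<le> \<bar>\<alpha> k * ((-1) ^ k * c)\<bar>"
        by simp
      also have "\<dots> = c * \<bar>\<alpha> k\<bar>"
        using c by (simp add: abs_mult power_abs)
      finally show "\<alpha> k * ((-1) ^ k * c) \<le> c * \<bar>\<alpha> k\<bar>" .
    qed
    also have "\<dots> \<le> norm (\<Sum>k=n..N. \<alpha> k *\<^sub>R x k)"
      using homog[OF \<open>n \<le> N\<close>] by (simp add: sum_distrib_left)
    also have "(\<Sum>k=n..N. \<alpha> k *\<^sub>R x k) = fst w"
      by (simp add: w p_def fst_sum)
    finally show ?thesis .
  qed
  obtain f where f: "linear f" "\<And>y. f y \<le> norm y"
    and fw: "\<And>w. w \<in> span (p ` {n..}) \<Longrightarrow> f (fst w) = snd w"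
    using Hahn_Banach_graph[OF subspace_span le] by blast
  have "f (x k) = (-1) ^ k * c" if "k \<ge> n" for k
    using fw[OF span_base, of "p k"] that by (auto simp: p_def)
  with f show thesis
    by (rule that)
qed

text \<open>
  The hypothesis \<open>dominate\<close> expresses that real functionals can be replaced by functionals over the
  scalar field of the space without decreasing absolute values. It is verified below for both
  scalar fields.
\<close>

lemma (in banach_space_over) two_eps_JR_le_delta:
  assumes bdd: "bounded (range x)"
    and dominate: "\<And>f. linear f \<Longrightarrow> (\<And>y. f y \<le> norm y) \<Longrightarrow>
      \<exists>F\<in>dual_ball sm. \<forall>y. \<bar>f y\<bar> \<le> norm (F y)"
  shows "2 * eps_JR x \<le> delta sm x"
proof -
  have "c \<le> delta sm x / 2" if c: "c < eps_JR x" for c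
  proof (cases "c \<ge> 0")
    case True
    then obtain f n where "linear f" "\<And>y. f y \<le> norm y"
      and f: "\<And>k. k \<ge> n \<Longrightarrow> f (x k) = (-1) ^ k * c"
      using alternating_functional[OF c] by blast
    then obtain F where F: "F \<in> dual_ball sm" and fF: "\<And>y. \<bar>f y\<bar> \<le> norm (F y)"
      using dominate by blast
    have "2 * c \<le> ca (\<lambda>n. F (x n))"
    proof (rule ca_greatest[OF bounded_dual_ball_image[OF F bdd]])
      fix m
      define k where "k = max m n"
      have "f (x k - x (Suc k)) = (-1) ^ k * (2 * c)"
        using f[of k] f[of "Suc k"] linear_diff[OF \<open>linear f\<close>] by (simp add: k_def)
      then have "2 * c \<le> \<bar>f (x k - x (Suc k))\<bar>"
        using True by (simp add: abs_mult power_abs)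
      also have "\<dots> \<le> dist (F (x k)) (F (x (Suc k)))"
        using fF[of "x k - x (Suc k)"] by (simp add: dual_ball_diff[OF F] dist_norm)
      finally show "\<exists>k\<ge>m. \<exists>l\<ge>m. 2 * c \<le> dist (F (x k)) (F (x l))"
        by (intro exI[of _ k] exI[of _ "Suc k"] conjI) (auto simp: k_def)
    qed
    also have "\<dots> \<le> delta sm x"
      by (rule ca_le_delta[OF bdd F])
    finally show ?thesis by simp
  next
    case False
    then show ?thesis
      using delta_nonneg[OF bdd] by simp
  qed
  then have "eps_JR x \<le> delta sm x / 2"
    by (rule dense_le)
  then show ?thesis by simp
qed

lemma real_functional_dominated_real:
  fixes f :: "'a::banach \<Rightarrow> real"
  assumes "linear f" "\<And>y. f y \<le> norm y"
  shows "\<exists>F\<in>dual_ball scaleR. \<forall>y. \<bar>f y\<bar> \<le> norm (F y)"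
proof -
  interpret banach_space_over "scaleR :: real \<Rightarrow> 'a \<Rightarrow> 'a"
    by (rule banach_space_over_scaleR)
  have "norm (f y) \<le> norm y" for y
    using assms(2)[of y] assms(2)[of "- y"] linear_neg[OF assms(1)] by (simp add: abs_le_iff)
  then have "f \<in> dual_ball scaleR"
    using linear_add[OF assms(1)] linear_scale[OF assms(1)] by (intro dual_ballI) auto
  then show ?thesis
    by auto
qed

text \<open>
  Complexification: \<open>f\<close> is the real part of the complex-linear functional \<open>y \<mapsto> f y - \<i> * f (\<i> * y)\<close>.
\<close>

lemma real_functional_dominated_complex:
  fixes f :: "'a::banach \<Rightarrow> real"
  assumes "banach_space_over sC" and f: "linear f" "\<And>y. f y \<le> norm y"
  shows "\<exists>F\<in>dual_ball (sC :: complex \<Rightarrow> _). \<forall>y. \<bar>f y\<bar> \<le> norm (F y)"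
proof -
  interpret banach_space_over sC by fact
  define F where "F y = Complex (f y) (- f (sC \<i> y))" for y
  have sC_eq: "sC c y = Re c *\<^sub>R y + Im c *\<^sub>R sC \<i> y" for c y
  proof -
    have "sC c y = sC (of_real (Re c) + of_real (Im c) * \<i>) y"
      by (metis complex_eq mult.commute)
    also have "\<dots> = sC (of_real (Re c)) y + sC (of_real (Im c)) (sC \<i> y)"
      by (simp add: scale_left_distrib)
    finally show ?thesis
      by (simp only: sm_of_real)
  qed
  have F_add: "F (y + z) = F y + F z" for y z
    by (simp add: F_def complex_eq_iff linear_add[OF f(1)] scale_right_distrib)
  have f_sC: "f (sC c y) = Re c * f y + Im c * f (sC \<i> y)" for c y
    unfolding sC_eq[of c y] using linear_add[OF f(1)] linear_scale[OF f(1)] by simp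
  have F_sC: "F (sC c y) = c * F y" for c y
    using f_sC[of c y] f_sC[of "\<i> * c" y] by (simp add: F_def complex_eq_iff)
  have "norm (F y) \<le> norm y" for y
  proof (cases "F y = 0")
    case False
    \<comment> \<open>a rotation that makes the value of \<open>F\<close> real and nonnegative\<close>
    define c where "c = cnj (sgn (F y))"
    have "F (sC c y) = of_real (norm (F y))"
      using False complex_norm_square[of "F y"]
      by (simp add: F_sC c_def sgn_eq power2_eq_square field_simps)
    then have "norm (F y) = f (sC c y)"
      by (simp add: F_def complex_eq_iff)
    also have "\<dots> \<le> norm (sC c y)"
      by (rule f)
    also have "\<dots> = norm y"
      using False by (simp add: norm_sm c_def norm_sgn)
    finally show ?thesis .
  qed simp
  then have "F \<in> dual_ball sC"
    using F_add F_sC by (intro dual_ballI) auto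
  moreover have "\<bar>f y\<bar> \<le> norm (F y)" for y
    using abs_Re_le_cmod[of "F y"] by (simp add: F_def)
  ultimately show ?thesis
    by blast
qed

section \<open>Upper bounds for the oscillation along subsequences\<close>

text \<open>
  Along a subsequence, values nearly \<open>w\<close> or \<open>- w\<close> can be prescribed at will, by functionals in the
  dual ball, on any initial segment. Local compactness of the scalar field is used to cover the values
  of all functionals in the dual ball on the bounded sequence by finitely many small balls.
\<close>

lemma ex_sign_functionals:
  fixes sm :: "'k::{real_normed_field,heine_borel} \<Rightarrow> 'a::banach \<Rightarrow> 'a"
  assumes "banach_space_over sm" and bdd: "bounded (range (x :: nat \<Rightarrow> 'a))"
    and d: "d < delta_sub sm x" and e: "e > 0"
  shows "\<exists>(r :: nat \<Rightarrow> nat) w. strict_mono r \<and> d - 2 * e < 2 * norm w \<and>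
    (\<forall>n \<sigma>. \<exists>g\<in>dual_ball sm. \<forall>k<n. dist (g (x (r k))) (if \<sigma> k then w else - w) < e)"
proof -
  interpret banach_space_over sm by fact
  obtain C where C: "\<And>n. norm (x n) \<le> C"
    using bdd by (auto simp: bounded_iff)
  have "seq_compact (cball (0::'k) C)"
    by (intro compact_imp_seq_compact compact_cball)
  then obtain D where "finite D" and D: "cball (0::'k) C \<subseteq> (\<Union>u\<in>D. ball u e)"
    using seq_compact_imp_totally_bounded e by metis
  define A where "A u n = {f \<in> dual_ball sm. f (x n) \<in> ball u e}" for u n
  define P where "P = {(u, v) \<in> D \<times> D. d - 2 * e < dist u v}"
  have "\<exists>(u, v)\<in>P. \<not> convergent_pairs_on (A u) (A v) M (dual_ball sm)" if M: "infinite M" for M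
  proof -
    define r where "r = enumerate M"
    have r: "strict_mono r" "range r = M"
      using M by (auto simp: r_def strict_mono_enumerate range_enumerate)
    have "d < delta sm (x \<circ> r)"
      using d delta_sub_le[OF bdd r(1)] by simp
    then obtain f where f: "f \<in> dual_ball sm" and caf: "d < ca (\<lambda>n. f (x (r n)))"
      by (auto elim: less_deltaD)
    have bf: "bounded (range (\<lambda>n. f (x (r n))))"
      using bounded_dual_ball_image[OF f bounded_range_compose[OF bdd]] by simp
    define T where "T u = {n. f (x (r n)) \<in> ball u e}" for u
    \<comment> \<open>Past some index \<open>m\<close>, only balls that are visited infinitely often are visited.\<close>
    have "finite (\<Union>u\<in>{u \<in> D. finite (T u)}. T u)"
      using \<open>finite D\<close> by auto
    then obtain m where m: "\<And>u n. u \<in> D \<Longrightarrow> finite (T u) \<Longrightarrow> n \<in> T u \<Longrightarrow> n < m"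
      unfolding finite_nat_iff_bounded by blast
    have ex: "\<exists>u\<in>D. k \<in> T u" for k
    proof -
      have "f (x (r k)) \<in> cball 0 C"
        using order_trans[OF norm_le_of_dual_ball[OF f] C] by simp
      then have "f (x (r k)) \<in> (\<Union>u\<in>D. ball u e)"
        using D by blast
      then show ?thesis
        by (auto simp: T_def)
    qed
    obtain k l where "k \<ge> m" "l \<ge> m" and kl: "d < dist (f (x (r k))) (f (x (r l)))"
      using less_caD[OF caf bf] by blast
    obtain u v where u: "u \<in> D" "k \<in> T u" and v: "v \<in> D" "l \<in> T v"
      using ex by blast
    have "infinite (T u)" "infinite (T v)"
      using m[of u k] m[of v l] u v \<open>k \<ge> m\<close> \<open>l \<ge> m\<close> by auto
    have "dist (f (x (r k))) (f (x (r l))) \<le> dist u (f (x (r k))) + dist u v + dist v (f (x (r l)))"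
      by metric
    with kl u v have "(u, v) \<in> P"
      by (auto simp: P_def T_def)
    moreover have inf: "infinite {n \<in> M. f \<in> A z n}" if "infinite (T z)" for z
    proof -
      have "r ` T z \<subseteq> {n \<in> M. f \<in> A z n}"
        using r f by (auto simp: T_def A_def)
      moreover have "infinite (r ` T z)"
        using that r(1) by (meson finite_imageD inj_on_subset strict_mono_imp_inj_on subset_UNIV)
      ultimately show ?thesis
        using finite_subset by blast
    qed
    ultimately show ?thesis
      using f inf[OF \<open>infinite (T u)\<close>] inf[OF \<open>infinite (T v)\<close>]
      unfolding convergent_pairs_on_def by blast
  qed
  moreover have "finite P"
    using \<open>finite D\<close> by (auto simp: P_def intro: finite_subset[of _ "D \<times> D"])
  ultimately obtain u v M where uv: "(u, v) \<in> P" and M: "infinite M"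
    and bad: "no_convergent_subseq (A u) (A v) M (dual_ball sm)"
    using ex_no_convergent_subseq[of P "\<lambda>p. A (fst p)" "\<lambda>p. A (snd p)" "dual_ball sm"]
    by (auto simp: case_prod_beta)
  obtain r :: "nat \<Rightarrow> nat" where r: "strict_mono r"
    and cell: "\<forall>n \<sigma>. dual_ball sm \<inter> (\<Inter>k<n. if \<sigma> k then A u (r k) else A v (r k)) \<noteq> {}"
    using independent_subsequence[OF M bad] by blast
  have "\<exists>g\<in>dual_ball sm. \<forall>k<n. dist (g (x (r k))) (if \<sigma> k then (u - v) / 2 else - ((u - v) / 2)) < e"
    for n \<sigma>
  proof -
    obtain f1 where f1: "f1 \<in> dual_ball sm" "\<And>k. k < n \<Longrightarrow> f1 \<in> (if \<sigma> k then A u (r k) else A v (r k))"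
      using spec[OF spec[OF cell, of n], of \<sigma>] by blast
    obtain f2 where f2: "f2 \<in> dual_ball sm" "\<And>k. k < n \<Longrightarrow> f2 \<in> (if \<not> \<sigma> k then A u (r k) else A v (r k))"
      using spec[OF spec[OF cell, of n], of "\<lambda>k. \<not> \<sigma> k"] by blast
    define g where "g y = (f1 y - f2 y) / 2" for y
    have "norm (g y) \<le> norm y" for y
      using norm_triangle_ineq4[of "f1 y" "f2 y"]
        norm_le_of_dual_ball[OF f1(1), of y] norm_le_of_dual_ball[OF f2(1), of y]
      by (simp add: g_def norm_divide)
    then have "g \<in> dual_ball sm"
      using f1(1) f2(1)
      by (intro dual_ballI) (auto simp: g_def dual_ball_add dual_ball_sm field_simps)
    moreover have "dist (g (x (r k))) (if \<sigma> k then (u - v) / 2 else - ((u - v) / 2)) < e" if "k < n" for k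
    proof -
      have half: "norm ((a - b) / 2 - (a' - b') / 2) < e" if "dist a' a < e" "dist b' b < e" for a b a' b' :: 'k
      proof -
        have eq: "(a - b) / 2 - (a' - b') / 2 = ((a - a') - (b - b')) / 2"
          by (simp add: field_simps)
        have "norm ((a - b) / 2 - (a' - b') / 2) \<le> (norm (a - a') + norm (b - b')) / 2"
          unfolding eq using norm_triangle_ineq4[of "a - a'" "b - b'"] by (simp add: norm_divide del: diff_divide_distrib)
        with that show ?thesis
          by (simp add: dist_norm norm_minus_commute)
      qed
      show ?thesis
        using f1(2)[OF that] f2(2)[OF that] half[of u "f1 (x (r k))" v "f2 (x (r k))"]
          half[of v "f1 (x (r k))" u "f2 (x (r k))"]
        by (auto simp: A_def g_def dist_norm minus_divide_left split: if_splits)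
    qed
    ultimately show ?thesis
      by blast
  qed
  moreover have "d - 2 * e < 2 * norm ((u - v) / 2)"
    using uv by (simp add: P_def dist_norm norm_divide)
  ultimately show ?thesis
    using r by blast
qed

text \<open>
  The field \<open>'c\<close> of coefficients may differ from the field \<open>'k\<close> of scalars, into which it is mapped by
  \<open>h\<close>; this covers real coefficients in complex spaces. The hypothesis \<open>signs\<close> provides the constant
  in the final estimate.
\<close>

lemma delta_sub_le_eps_J_sub:
  fixes sm :: "'k::{real_normed_field,heine_borel} \<Rightarrow> 'a::banach \<Rightarrow> 'a"
    and smc :: "'c::real_normed_field \<Rightarrow> 'a \<Rightarrow> 'a"
  assumes sm: "banach_space_over sm" and smc: "banach_space_over smc"
    and h: "\<And>c y. smc c y = sm (h c) y" "\<And>c. norm (h c) = norm c"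
    and \<kappa>: "\<kappa> \<ge> 0"
    and signs: "\<And>(n::nat) N a. \<exists>\<sigma>. \<kappa> * (\<Sum>k=n..N. norm (a k)) \<le>
      norm (\<Sum>k=n..N. if \<sigma> k then h (a k) else - h (a k))"
    and bdd: "bounded (range (x :: nat \<Rightarrow> 'a))"
  shows "\<kappa> * delta_sub sm x \<le> 2 * eps_J_sub smc x"
proof (rule field_le_epsilon)
  interpret banach_space_over sm by fact
  interpret c: banach_space_over smc by fact
  fix \<epsilon> :: real assume "\<epsilon> > 0"
  \<comment> \<open>The errors add up to \<open>3 * \<kappa> * e\<close> from \<open>w\<close> and \<open>2 * e\<close> from the values of the functional.\<close>
  define e where "e = \<epsilon> / (3 * \<kappa> + 2)"
  have e: "e > 0" "(3 * \<kappa> + 2) * e = \<epsilon>"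
    using \<open>\<epsilon> > 0\<close> \<kappa> by (auto simp: e_def)
  obtain r :: "nat \<Rightarrow> nat" and w where r: "strict_mono r" and w: "(delta_sub sm x - e) - 2 * e < 2 * norm w"
    and func: "\<forall>n \<sigma>. \<exists>g\<in>dual_ball sm. \<forall>k<n. dist (g (x (r k))) (if \<sigma> k then w else - w) < e"
    using ex_sign_functionals[OF sm bdd, of "delta_sub sm x - e" e] e by auto
  have "\<kappa> * norm w - e \<le> eps_J smc (x \<circ> r)"
  proof (rule c.eps_J_greatest[OF bounded_range_compose[OF bdd]])
    fix N and a :: "nat \<Rightarrow> 'c"
    assume "0 \<le> N" and a: "(\<Sum>k=0..N. norm (a k)) = 1"
    obtain \<sigma> where \<sigma>: "\<kappa> * (\<Sum>k=0..N. norm (a k)) \<le>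
      norm (\<Sum>k=0..N. if \<sigma> k then h (a k) else - h (a k))"
      using signs by blast
    obtain g where g: "g \<in> dual_ball sm"
      and gw: "\<And>k. k \<le> N \<Longrightarrow> dist (g (x (r k))) (if \<sigma> k then w else - w) < e"
      using spec[OF spec[OF func, of "Suc N"], of \<sigma>] by (auto simp: less_Suc_eq_le)
    let ?w = "\<lambda>k. if \<sigma> k then w else - w"
    have "\<kappa> * norm w \<le> norm (\<Sum>k=0..N. if \<sigma> k then h (a k) else - h (a k)) * norm w"
      using \<sigma> a by (intro mult_right_mono) auto
    also have "\<dots> = norm (\<Sum>k=0..N. h (a k) * ?w k)"
      by (simp add: norm_mult[symmetric] sum_distrib_right if_distrib if_distribR cong: if_cong)
    also have "(\<Sum>k=0..N. h (a k) * ?w k) =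
        g (\<Sum>k=0..N. sm (h (a k)) (x (r k))) - (\<Sum>k=0..N. h (a k) * (g (x (r k)) - ?w k))"
      by (simp add: dual_ball_sum[OF g] dual_ball_sm[OF g] right_diff_distrib sum_subtractf)
    also have "norm \<dots> \<le> norm (g (\<Sum>k=0..N. sm (h (a k)) (x (r k)))) +
        norm (\<Sum>k=0..N. h (a k) * (g (x (r k)) - ?w k))"
      by (rule norm_triangle_ineq4)
    also have "norm (g (\<Sum>k=0..N. sm (h (a k)) (x (r k)))) \<le> norm (\<Sum>k=0..N. sm (h (a k)) (x (r k)))"
      by (rule norm_le_of_dual_ball[OF g])
    also have "norm (\<Sum>k=0..N. h (a k) * (g (x (r k)) - ?w k)) \<le> (\<Sum>k=0..N. norm (a k) * e)"
    proof (rule sum_norm_le)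
      fix k assume "k \<in> {0..N}"
      then have "norm (g (x (r k)) - ?w k) \<le> e"
        using gw[of k] by (simp add: dist_norm)
      then show "norm (h (a k) * (g (x (r k)) - ?w k)) \<le> norm (a k) * e"
        unfolding norm_mult h by (rule mult_left_mono) simp
    qed
    also have "\<dots> = e"
      using a by (simp flip: sum_distrib_right)
    finally show "\<kappa> * norm w - e \<le> norm (\<Sum>k=0..N. smc (a k) ((x \<circ> r) k))"
      by (simp add: h)
  qed
  also have "\<dots> \<le> eps_J_sub smc x"
    using bdd r by (rule c.eps_J_le_eps_J_sub)
  finally have "2 * (\<kappa> * norm w) \<le> 2 * eps_J_sub smc x + 2 * e"
    by simp
  moreover have "\<kappa> * (delta_sub sm x - 3 * e) \<le> \<kappa> * (2 * norm w)"
    using w \<kappa> by (intro mult_left_mono) auto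
  ultimately show "\<kappa> * delta_sub sm x \<le> 2 * eps_J_sub smc x + \<epsilon>"
    using e(2) by (simp add: algebra_simps)
qed

section \<open>Choosing signs\<close>

lemma has_integral_abs_sin:
  assumes "0 \<le> \<phi>" "\<phi> \<le> pi"
  shows "((\<lambda>\<theta>. \<bar>sin (\<phi> - \<theta>)\<bar>) has_integral 2) {0..pi}"
proof -
  have "((\<lambda>\<theta>. sin (\<phi> - \<theta>)) has_integral (cos (\<phi> - \<phi>) - cos (\<phi> - 0))) {0..\<phi>}"
    by (rule fundamental_theorem_of_calculus)
      (auto intro!: derivative_eq_intros simp: assms has_real_derivative_iff_has_vector_derivative[symmetric])
  then have 1: "((\<lambda>\<theta>. \<bar>sin (\<phi> - \<theta>)\<bar>) has_integral (cos (\<phi> - \<phi>) - cos (\<phi> - 0))) {0..\<phi>}"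
    by (rule has_integral_eq[rotated]) (use assms in \<open>auto intro!: abs_of_nonneg[symmetric] sin_ge_zero\<close>)
  have "((\<lambda>\<theta>. - sin (\<phi> - \<theta>)) has_integral (- cos (\<phi> - pi) - - cos (\<phi> - \<phi>))) {\<phi>..pi}"
    by (rule fundamental_theorem_of_calculus)
      (auto intro!: derivative_eq_intros simp: assms has_real_derivative_iff_has_vector_derivative[symmetric])
  then have 2: "((\<lambda>\<theta>. \<bar>sin (\<phi> - \<theta>)\<bar>) has_integral (- cos (\<phi> - pi) - - cos (\<phi> - \<phi>))) {\<phi>..pi}"
  proof (rule has_integral_eq[rotated])
    fix \<theta> assume "\<theta> \<in> {\<phi>..pi}"
    then have "0 \<le> sin (\<theta> - \<phi>)"
      using assms by (intro sin_ge_zero) auto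
    moreover have "sin (\<theta> - \<phi>) = - sin (\<phi> - \<theta>)"
      by (metis minus_diff_eq sin_minus)
    ultimately show "- sin (\<phi> - \<theta>) = \<bar>sin (\<phi> - \<theta>)\<bar>"
      by simp
  qed
  show ?thesis
    using has_integral_combine[OF assms 1 2] by (simp add: cos_diff)
qed

text \<open>
  The mean of \<open>\<bar>Im (cis (- \<theta>) * z)\<bar>\<close> over \<open>\<theta>\<close> in \<open>{0..pi}\<close> is \<open>2 / pi * norm z\<close>; a maximizing angle
  for the sum is at least as good as the mean, and the signs are those of the imaginary parts.
\<close>

lemma complex_signs:
  fixes a :: "nat \<Rightarrow> complex"
  assumes "finite K"
  shows "\<exists>\<sigma>. 2 / pi * (\<Sum>k\<in>K. norm (a k)) \<le> norm (\<Sum>k\<in>K. if \<sigma> k then a k else - a k)"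
proof -
  \<comment> \<open>Up to sign, all the arguments may be taken in \<open>{0..pi}\<close>.\<close>
  have "\<exists>\<phi>. 0 \<le> \<phi> \<and> \<phi> \<le> pi \<and> (z = norm z * cis \<phi> \<or> z = - (norm z * cis \<phi>))" for z :: complex
  proof (cases "Im z \<ge> 0")
    case True
    then show ?thesis
      using Arg_le_pi[of z] Arg_less_0[of z] rcis_cmod_Arg[of z]
      by (intro exI[of _ "Arg z"]) (auto simp: rcis_def)
  next
    case False
    then show ?thesis
      using Arg_le_pi[of "- z"] Arg_less_0[of "- z"] rcis_cmod_Arg[of "- z"]
      by (intro exI[of _ "Arg (- z)"]) (auto simp: rcis_def minus_equation_iff)
  qed
  then have "\<forall>k. \<exists>\<phi>. 0 \<le> \<phi> \<and> \<phi> \<le> pi \<and> (a k = norm (a k) * cis \<phi> \<or> a k = - (norm (a k) * cis \<phi>))"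
    by blast
  from choice[OF this] obtain \<phi> where \<phi>: "\<And>k. 0 \<le> \<phi> k" "\<And>k. \<phi> k \<le> pi"
    and a: "\<And>k. a k = norm (a k) * cis (\<phi> k) \<or> a k = - (norm (a k) * cis (\<phi> k))"
    by blast
  have Im: "\<bar>Im (cis (- \<theta>) * a k)\<bar> = norm (a k) * \<bar>sin (\<phi> k - \<theta>)\<bar>" for \<theta> k
  proof -
    have "Im (cis (- \<theta>) * (norm (a k) * cis (\<phi> k))) = norm (a k) * sin (\<phi> k - \<theta>)"
      by (simp add: sin_diff algebra_simps)
    moreover have "\<bar>Im (cis (- \<theta>) * a k)\<bar> = \<bar>Im (cis (- \<theta>) * (norm (a k) * cis (\<phi> k)))\<bar>"
      using a[of k] by (elim disjE, metis)
        (metis abs_minus_cancel mult_minus_right uminus_complex.simps(2))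
    ultimately show ?thesis
      by (simp only: abs_mult abs_norm_cancel)
  qed
  define G where "G \<theta> = (\<Sum>k\<in>K. norm (a k) * \<bar>sin (\<phi> k - \<theta>)\<bar>)" for \<theta>
  have "continuous_on {0..pi} G"
    unfolding G_def by (intro continuous_intros)
  then obtain \<theta> where max: "\<forall>\<theta>'\<in>{0..pi}. G \<theta>' \<le> G \<theta>"
    using continuous_attains_sup[of "{0..pi}" G] by auto
  have "(G has_integral (\<Sum>k\<in>K. norm (a k) * 2)) {0..pi}"
    unfolding G_def using \<phi> assms
    by (intro has_integral_sum has_integral_mult_right has_integral_abs_sin) auto
  moreover have "((\<lambda>_. G \<theta>) has_integral (pi * G \<theta>)) {0..pi}"
    using has_integral_const_real[of "G \<theta>" 0 pi] by simp
  ultimately have "(\<Sum>k\<in>K. norm (a k) * 2) \<le> pi * G \<theta>"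
    by (rule has_integral_le) (use max in blast)
  then have "2 / pi * (\<Sum>k\<in>K. norm (a k)) \<le> G \<theta>"
    by (simp add: field_simps flip: sum_distrib_left)
  also have "G \<theta> = Im (cis (- \<theta>) * (\<Sum>k\<in>K. if 0 \<le> Im (cis (- \<theta>) * a k) then a k else - a k))"
    unfolding G_def Im[symmetric] sum_distrib_left Im_sum
    by (intro sum.cong) auto
  also have "\<dots> \<le> norm (cis (- \<theta>) * (\<Sum>k\<in>K. if 0 \<le> Im (cis (- \<theta>) * a k) then a k else - a k))"
    using abs_Im_le_cmod by (meson abs_ge_self order_trans)
  also have "\<dots> = norm (\<Sum>k\<in>K. if 0 \<le> Im (cis (- \<theta>) * a k) then a k else - a k)"
    by (simp add: norm_mult)
  finally show ?thesis
    by (rule exI[of _ "\<lambda>k. 0 \<le> Im (cis (- \<theta>) * a k)"])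
qed

lemma real_signs:
  fixes a :: "nat \<Rightarrow> real"
  shows "\<exists>\<sigma>. 1 * (\<Sum>k\<in>K. norm (a k)) \<le>
    norm (\<Sum>k\<in>K. if \<sigma> k then of_real (a k) else - of_real (a k) :: 'k::real_normed_field)"
proof (intro exI)
  have "(\<Sum>k\<in>K. norm (a k)) = (\<Sum>k\<in>K. if 0 \<le> a k then a k else - a k)"
    by (intro sum.cong) auto
  also have "\<dots> \<le> norm (of_real (\<Sum>k\<in>K. if 0 \<le> a k then a k else - a k) :: 'k)"
    by (simp only: norm_of_real abs_ge_self)
  also have "(of_real (\<Sum>k\<in>K. if 0 \<le> a k then a k else - a k) :: 'k) =
      (\<Sum>k\<in>K. if 0 \<le> a k then of_real (a k) else - of_real (a k))"
    by (auto intro!: sum.cong)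
  finally show "1 * (\<Sum>k\<in>K. norm (a k)) \<le>
      norm (\<Sum>k\<in>K. if 0 \<le> a k then of_real (a k) else - of_real (a k) :: 'k)"
    by simp
qed

lemma (in banach_space_over) two_eps_JR_le_delta_sub_and_two_eps_JR_sub_le_delta:
  assumes bdd: "bounded (range x)"
    and dominate: "\<And>f. linear f \<Longrightarrow> (\<And>y. f y \<le> norm y) \<Longrightarrow>
      \<exists>F\<in>dual_ball sm. \<forall>y. \<bar>f y\<bar> \<le> norm (F y)"
  shows "2 * eps_JR x \<le> delta_sub sm x" and "2 * eps_JR_sub x \<le> delta sm x"
proof -
  interpret R: banach_space_over "scaleR :: real \<Rightarrow> 'a \<Rightarrow> 'a"
    by (rule banach_space_over_scaleR)
  have sub: "2 * eps_JR (x \<circ> r) \<le> delta sm (x \<circ> r)" for r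
    using bounded_range_compose[OF bdd] dominate by (rule two_eps_JR_le_delta)
  show "2 * eps_JR x \<le> delta_sub sm x"
  proof (rule delta_sub_greatest)
    fix r :: "nat \<Rightarrow> nat" assume "strict_mono r"
    then show "2 * eps_JR x \<le> delta sm (x \<circ> r)"
      using sub[of r] R.eps_J_le_subseq[OF bdd] by (fastforce simp: eps_JR_def)
  qed
  have "eps_JR_sub x \<le> delta sm x / 2"
    unfolding eps_JR_sub_eq
  proof (rule R.eps_J_sub_least)
    fix r :: "nat \<Rightarrow> nat" assume "strict_mono r"
    then show "eps_J scaleR (x \<circ> r) \<le> delta sm x / 2"
      using sub[of r] delta_subseq_le[OF bdd] by (fastforce simp: eps_JR_def)
  qed
  then show "2 * eps_JR_sub x \<le> delta sm x"
    by simp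
qed

section \<open>Comparison of the quantities\<close>

theorem theorem3p1:
  fixes x :: "nat \<Rightarrow> 'a::banach"
  assumes "bounded (range x)"
  shows
    "((delta scaleR x \<ge> 2 * eps_JR x \<and> 2 * eps_JR x \<ge> 2 * eps_J scaleR x) \<and>
      (delta_sub scaleR x \<ge> 2 * eps_JR x \<and> 2 * eps_JR x \<ge> 2 * eps_J scaleR x) \<and>
      (delta scaleR x \<ge> 2 * eps_JR_sub x \<and> 2 * eps_JR_sub x \<ge> 2 * eps_J_sub scaleR x) \<and>
      delta_sub scaleR x \<le> 2 * eps_JR_sub x) \<and>
     (\<forall>sC :: complex \<Rightarrow> 'a \<Rightarrow> 'a. banach_space_over sC \<longrightarrow>
        (delta sC x \<ge> 2 * eps_JR x \<and> 2 * eps_JR x \<ge> 2 * eps_J sC x) \<and>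
        (delta_sub sC x \<ge> 2 * eps_JR x \<and> 2 * eps_JR x \<ge> 2 * eps_J sC x) \<and>
        (delta sC x \<ge> 2 * eps_JR_sub x \<and> 2 * eps_JR_sub x \<ge> 2 * eps_J_sub sC x) \<and>
        delta_sub sC x \<le> 2 * eps_JR_sub x \<and>
        delta_sub sC x \<le> pi * eps_J_sub sC x)"
proof -
  interpret R: banach_space_over "scaleR :: real \<Rightarrow> 'a \<Rightarrow> 'a"
    by (rule banach_space_over_scaleR)
  have "delta_sub scaleR x \<le> 2 * eps_JR_sub x"
    using delta_sub_le_eps_J_sub[OF banach_space_over_scaleR banach_space_over_scaleR
        _ _ _ real_signs assms]
    by (simp add: eps_JR_sub_eq)
  moreover have "(delta sC x \<ge> 2 * eps_JR x \<and> 2 * eps_JR x \<ge> 2 * eps_J sC x) \<and>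
        (delta_sub sC x \<ge> 2 * eps_JR x \<and> 2 * eps_JR x \<ge> 2 * eps_J sC x) \<and>
        (delta sC x \<ge> 2 * eps_JR_sub x \<and> 2 * eps_JR_sub x \<ge> 2 * eps_J_sub sC x) \<and>
        delta_sub sC x \<le> 2 * eps_JR_sub x \<and>
        delta_sub sC x \<le> pi * eps_J_sub sC x"
    if sC: "banach_space_over sC" for sC :: "complex \<Rightarrow> 'a \<Rightarrow> 'a"
  proof -
    interpret C: banach_space_over sC by fact
    have "delta_sub sC x \<le> 2 * eps_JR_sub x"
      using delta_sub_le_eps_J_sub[OF sC banach_space_over_scaleR
          _ _ _ real_signs assms]
      by (simp add: eps_JR_sub_eq C.sm_of_real)
    moreover have "2 / pi * delta_sub sC x \<le> 2 * eps_J_sub sC x"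
      by (rule delta_sub_le_eps_J_sub[OF sC sC, of "\<lambda>c. c"]) (use assms complex_signs in auto)
    ultimately show ?thesis
      using C.two_eps_JR_le_delta[OF assms real_functional_dominated_complex[OF sC]]
        C.two_eps_JR_le_delta_sub_and_two_eps_JR_sub_le_delta[OF assms real_functional_dominated_complex[OF sC]]
        C.eps_J_le_eps_JR[OF assms] C.eps_J_sub_le_eps_JR_sub[OF assms]
      by (simp add: field_simps)
  qed
  ultimately show ?thesis
    using R.two_eps_JR_le_delta[OF assms real_functional_dominated_real]
      R.two_eps_JR_le_delta_sub_and_two_eps_JR_sub_le_delta[OF assms real_functional_dominated_real]
      R.eps_J_le_eps_JR[OF assms] R.eps_J_sub_le_eps_JR_sub[OF assms]
    by simp
qed

end
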